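(* There exists an infinite arithmetic progression of positive integers, none of which can be written as $p+F_{2^k}+F_q$, where $p,q$ are primes and $k\ge 0$ is an integer. Consequently, the set of positive integers not representable in the form $p+F_{2^k}+F_q$ with $p,q$ primes and $k\ge 0$ an integer has positive lower asymptotic density.
   Context: $F_n$ denotes the $n$-th Fibonacci number: $F_0=0$, $F_1=1$, $F_{n+2}=F_{n+1}+F_n$ for $n\ge 0$. The lower asymptotic density of a set $A$ of positive integers is $\liminf_{x\to\infty}\frac{1}{x}\#\{n\in A: n\le x\}$. *)

theory Defs
  imports
    "HOL-Number_Theory.Fib"
    "HOL-Computational_Algebra.Primes"
    "HOL-Library.Extended_Real"
begin

definition representable :: "nat \<Rightarrow> bool" where
  "representable n \<longleftrightarrow>
     (\<exists>p q k. prime p \<and> prime q \<and> n = p + fib (2 ^ k) + fib q)"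

(* x ranges over the reals. The values are taken in ereal because Liminf needs a
   complete lattice; the quotient lies in [0, 1] for x > 0, so no infinity arises.
   The condition 0 < n restricts the count to positive integers. *)
definition lower_density :: "nat set \<Rightarrow> ereal" where
  "lower_density A =
     Liminf at_top (\<lambda>x::real. ereal (real (card {n \<in> A. 0 < n \<and> real n \<le> x}) / x))"

end

theory Submission
  imports Defs
begin

text \<open>
  The progression is \<open>98 + 210 j\<close>. Unless \<open>q = 3\<close>, both \<open>fib q\<close> and \<open>fib (2 ^ k)\<close> are odd, so an
  even number \<open>n = p + fib (2 ^ k) + fib q\<close> has \<open>p = 2\<close>; if \<open>q = 3\<close>, then
  \<open>n - 2 = p + fib (2 ^ k)\<close>. Since \<open>fib 4 = 3\<close> divides \<open>fib (2 ^ k)\<close> for \<open>k \<ge> 2\<close> and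
  \<open>fib 8 = 21\<close> does for \<open>k \<ge> 3\<close>, while \<open>3 = fib 4\<close> divides no \<open>fib q\<close> and \<open>5 = fib 5\<close> only
  \<open>fib 5\<close>, the residues of \<open>n\<close> modulo 3, 5 and 7 exclude all remaining cases.
\<close>

text \<open>The increment is \<open>fib (n - 1)\<close>, which vanishes at
  \<open>n = 1\<close>.\<close>

lemma fib_less_fib_Suc:
  assumes "2 \<le> n"
  shows "fib n < fib (Suc n)"
proof -
  obtain l where "n = Suc (Suc l)"
    using assms by (metis add_2_eq_Suc le_Suc_ex)
  then show ?thesis
    using fib_neq_0_nat[of "Suc l"] by simp
qed

text \<open>By \<open>fib_gcd\<close>, divisibility means \<open>fib (gcd m n) = fib m\<close>. A
  gcd below \<open>m\<close> would give at most \<open>fib (m - 1)\<close>, which is smaller than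
  \<open>fib m\<close> because \<open>m - 1\<close> is at least 2.\<close>

lemma fib_dvd_fib_iff:
  assumes "2 < m"
  shows "fib m dvd fib n \<longleftrightarrow> m dvd n"
proof
  assume "m dvd n"
  then have "gcd m n = m"
    by (rule gcd_nat.absorb1)
  then show "fib m dvd fib n"
    using fib_gcd[of m n] by (metis gcd_dvd2)
next
  assume "fib m dvd fib n"
  then have eq: "fib (gcd m n) = fib m"
    unfolding fib_gcd by (rule gcd_nat.absorb1)
  have less: "fib (m - 1) < fib m"
    using fib_less_fib_Suc[of "m - 1"] assms by simp
  have "gcd m n = m"
  proof (rule ccontr)
    assume "gcd m n \<noteq> m"
    moreover have "gcd m n \<le> m"
      using assms by (intro gcd_le1_nat) simp
    ultimately have "fib (gcd m n) \<le> fib (m - 1)"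
      by (intro fib_mono) linarith
    then show False
      using eq less by linarith
  qed
  then show "m dvd n"
    by (metis gcd_dvd2)
qed

lemma fib_numerals: "fib 3 = 2" "fib 4 = 3" "fib 5 = 5" "fib 8 = 21"
  by (simp_all add: numeral_eq_Suc)

lemma even_fib_iff: "even (fib n) \<longleftrightarrow> 3 dvd n"
  using fib_dvd_fib_iff[of 3 n] by (simp add: fib_numerals)

lemma three_dvd_fib_iff: "3 dvd fib n \<longleftrightarrow> 4 dvd n"
  using fib_dvd_fib_iff[of 4 n] by (simp add: fib_numerals)

lemma five_dvd_fib_iff: "5 dvd fib n \<longleftrightarrow> 5 dvd n"
  using fib_dvd_fib_iff[of 5 n] by (simp add: fib_numerals)

lemma seven_dvd_fib_if:
  assumes "8 dvd n"
  shows "7 dvd fib n"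
proof -
  have "21 dvd fib n"
    using assms fib_dvd_fib_iff[of 8 n] by (simp add: fib_numerals)
  then show ?thesis
    by (rule dvd_trans[rotated]) simp
qed

lemma three_not_dvd_power_two: "\<not> 3 dvd (2::nat) ^ k"
proof
  assume "3 dvd (2::nat) ^ k"
  then have "3 dvd (2::nat)"
    by (rule prime_dvd_power[rotated]) simp
  then show False
    by simp
qed

lemma four_dvd_power_two: "2 \<le> k \<Longrightarrow> 4 dvd (2::nat) ^ k"
  using le_imp_power_dvd[of 2 k "2::nat"] by simp

lemma eight_dvd_power_two: "3 \<le> k \<Longrightarrow> 8 dvd (2::nat) ^ k"
  using le_imp_power_dvd[of 3 k "2::nat"] by simp

text \<open>With \<open>three_dvd_fib_iff\<close> this keeps 3 from dividing \<open>fib q\<close>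
  for prime \<open>q\<close>.\<close>

lemma four_not_dvd_prime:
  fixes q :: nat
  assumes "prime q"
  shows "\<not> 4 dvd q"
proof
  assume "4 dvd q"
  then have "even q"
    by (metis dvd_trans even_numeral)
  then have "q = 2"
    using assms primes_dvd_imp_eq two_is_prime_nat by blast
  then show False
    using \<open>4 dvd q\<close> by simp
qed

lemma fib_power_two_eq_one: "k < 2 \<Longrightarrow> fib (2 ^ k) = 1"
  by (auto simp: less_2_cases_iff)

text \<open>The modulus is 2 * 3 * 5 * 7; 98 is even and congruent to 2 modulo 3, 3 modulo 5 and 0
  modulo 7. So 3 divides \<open>n - 2\<close> and \<open>n - 5\<close>, 5 divides
  \<open>n - 3\<close>, and 7 does not divide \<open>n - 5\<close>.\<close>

lemma not_representable_98_plus_210_mult: "\<not> representable (98 + j * 210)"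
proof
  assume "representable (98 + j * 210)"
  then obtain p q k
    where p: "prime p" and q: "prime q" and n: "98 + j * 210 = p + fib (2 ^ k) + fib q"
    unfolding representable_def by blast
  show False
  proof (cases "q = 3")
    case False
    then have "odd (fib q)"
      using q primes_dvd_imp_eq[of 3 q] by (auto simp: even_fib_iff)
    moreover have "odd (fib (2 ^ k))"
      by (simp add: even_fib_iff three_not_dvd_power_two)
    moreover have "even (p + fib (2 ^ k) + fib q)"
      unfolding n[symmetric] by simp
    ultimately have "even p"
      by simp
    then have "p = 2"
      using p primes_dvd_imp_eq two_is_prime_nat by blast
    show False
    proof (cases "2 \<le> k")
      case True
      then have "3 dvd fib (2 ^ k)"
        by (simp add: three_dvd_fib_iff four_dvd_power_two)
      moreover have "3 dvd fib (2 ^ k) + fib q"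
      proof -
        have "fib (2 ^ k) + fib q = 96 + j * 210"
          using n \<open>p = 2\<close> by simp
        then show ?thesis
          by (simp only:) (intro dvd_add dvd_mult; simp)
      qed
      ultimately have "3 dvd fib q"
        by (simp add: dvd_add_right_iff)
      then show False
        using q four_not_dvd_prime by (simp add: three_dvd_fib_iff)
    next
      case False
      then have fib_q: "fib q = 95 + j * 210"
        using n \<open>p = 2\<close> by (simp add: fib_power_two_eq_one)
      have "5 dvd fib q"
        unfolding fib_q by (intro dvd_add dvd_mult; simp)
      then have "q = 5"
        using q primes_dvd_imp_eq[of 5 q] by (simp add: five_dvd_fib_iff)
      \<comment> \<open>Size decides: \<open>fib 5 = 5\<close> is below 95.\<close>
      then show False
        using fib_q by (simp add: fib_numerals)
    qed
  next
    case True
    then have n': "96 + j * 210 = p + fib (2 ^ k)"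
      using n by (simp add: fib_numerals)
    consider "k < 2" | "k = 2" | "3 \<le> k"
      by linarith
    then show False
    proof cases
      case 1
      then have p_eq: "p = 95 + j * 210"
        using n' by (simp add: fib_power_two_eq_one)
      have "5 dvd p"
        unfolding p_eq by (intro dvd_add dvd_mult; simp)
      then show False
        using p p_eq primes_dvd_imp_eq[of 5 p] by simp
    next
      case 2
      then have p_eq: "p = 93 + j * 210"
        using n' by (simp add: fib_numerals)
      have "3 dvd p"
        unfolding p_eq by (intro dvd_add dvd_mult; simp)
      then show False
        using p p_eq primes_dvd_imp_eq[of 3 p] by simp
    next
      \<comment> \<open>Here \<open>fib (2 ^ k)\<close> is unbounded, so size cannot exclude
        \<open>p = 3\<close>, the one prime that modulo 3 leaves. Modulo 7 does, since 93 = 13 * 7 +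
        2.\<close>
      case 3
      have "3 dvd p + fib (2 ^ k)"
        unfolding n'[symmetric] by (intro dvd_add dvd_mult; simp)
      moreover have "3 dvd fib (2 ^ k)"
        using 3 by (simp add: three_dvd_fib_iff four_dvd_power_two)
      ultimately have "p = 3"
        using p primes_dvd_imp_eq[of 3 p] by (simp add: dvd_add_left_iff)
      moreover have "7 dvd fib (2 ^ k)"
        using 3 by (simp add: seven_dvd_fib_if eight_dvd_power_two)
      ultimately have "7 dvd 93 + j * 210"
        using n' by simp
      moreover have "7 dvd j * 210"
        by (intro dvd_mult) simp
      ultimately have "7 dvd (93::nat)"
        by (simp only: dvd_add_left_iff)
      then show False
        by simp
    qed
  qed
qed

lemma lower_density_pos_if_arith_prog:
  assumes "0 < a" and "0 < d" and sub: "\<And>j. a + j * d \<in> A"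
  shows "0 < lower_density A"
proof -
  \<comment> \<open>Half of the true density \<open>1 / d\<close> absorbs the offset:
    \<open>x - a\<close> is at least \<open>x / 2\<close> once \<open>x \<ge> 2 * a\<close>.\<close>
  have "\<forall>\<^sub>F x in at_top. ereal (1 / (2 * d)) \<le>
      ereal (real (card {n \<in> A. 0 < n \<and> real n \<le> x}) / x)"
    using eventually_ge_at_top[of "2 * real a"]
  proof eventually_elim
    case (elim x)
    \<comment> \<open>The largest index whose term is at most \<open>x\<close>; the floor is
      nonnegative because \<open>x \<ge> a\<close>, so \<open>nat\<close> does not truncate
      it.\<close>
    define m where "m = nat \<lfloor>(x - a) / d\<rfloor>"
    have "0 < x"
      using elim \<open>0 < a\<close> by linarith
    have m_le: "real m \<le> (x - a) / d" and m_gt: "(x - a) / d < real m + 1"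
      using elim \<open>0 < d\<close> unfolding m_def by (auto intro: of_nat_floor)
    have "a + j * d \<in> {n \<in> A. 0 < n \<and> real n \<le> x}" if "j \<le> m" for j
    proof -
      have "real j \<le> (x - a) / d"
        using that m_le by linarith
      then have "a + real j * d \<le> x"
        using \<open>0 < d\<close> by (simp add: field_simps)
      then show ?thesis
        using sub \<open>0 < a\<close> by simp
    qed
    \<comment> \<open>\<open>card\<close> is 0 on infinite sets, so its monotonicity requires
      finiteness.\<close>
    moreover have "finite {n \<in> A. 0 < n \<and> real n \<le> x}"
      by (rule finite_subset[of _ "{..nat \<lfloor>x\<rfloor>}"]) (auto simp: le_nat_floor)
    ultimately have "card ((\<lambda>j. a + j * d) ` {..m}) \<le> card {n \<in> A. 0 < n \<and> real n \<le> x}"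
      by (intro card_mono) auto
    \<comment> \<open>Counting index 0 gives the extra 1 that makes up for the rounding in
      \<open>m\<close>.\<close>
    moreover have "card ((\<lambda>j. a + j * d) ` {..m}) = m + 1"
      using \<open>0 < d\<close> by (subst card_image) (auto simp: inj_on_def)
    ultimately have "(x - a) / d \<le> card {n \<in> A. 0 < n \<and> real n \<le> x}"
      using m_gt by linarith
    moreover have "x / (2 * d) \<le> (x - a) / d"
      using elim \<open>0 < d\<close> by (simp add: field_simps)
    ultimately have "x / (2 * d) \<le> card {n \<in> A. 0 < n \<and> real n \<le> x}"
      by linarith
    then show ?case
      using \<open>0 < x\<close> \<open>0 < d\<close> by (simp add: field_simps)
  qed
  then have "ereal (1 / (2 * d)) \<le> lower_density A"
    unfolding lower_density_def by (rule Liminf_bounded)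
  moreover have "0 < ereal (1 / (2 * d))"
    using \<open>0 < d\<close> by simp
  ultimately show ?thesis
    by (rule less_le_trans[rotated])
qed

theorem theorem1p1:
  shows "(\<exists>a d :: nat. a > 0 \<and> d > 0 \<and> (\<forall>j :: nat. \<not> representable (a + j * d))) \<and>
         lower_density {n :: nat. n > 0 \<and> \<not> representable n} > 0"
proof
  show "\<exists>a d :: nat. a > 0 \<and> d > 0 \<and> (\<forall>j :: nat. \<not> representable (a + j * d))"
    using not_representable_98_plus_210_mult
    by (intro exI[of _ "98::nat"] exI[of _ "210::nat"]) simp
  show "lower_density {n :: nat. n > 0 \<and> \<not> representable n} > 0"
    using not_representable_98_plus_210_mult
    by (intro lower_density_pos_if_arith_prog[of 98 210]) simp_all
qed

end
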